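(* Let $\tau_1$ be a topology on $Z\times\mathcal V$ and $\tau_2$ a topology on $\mathcal C$ such that the following hold. (T1) Sublevel sets of $R_1$ are $\tau_1$-compact, and sublevel sets of $R_2$ are $\tau_2$-compact. (T2) For all sequences $(\zeta^j,u^j,f^j,y^j)_{j\in\mathbb N}\subseteq Z\times\mathcal V\times\mathcal C\times\mathcal Y$: if $(\zeta^j,u^j,f^j)\to(\bar\zeta,\bar u,\bar f)$ in $\tau_1\times\tau_2$, $Q(E(\zeta^j,u^j,f^j))\to0$, $S(Mu^j,y^j)\to0$ and $S(y,y^j)\to0$, then $Q(E(\bar\zeta,\bar u,\bar f))=0$ and $S(M\bar u,y)=0$. (T3) For all sequences $(\zeta^j,u^j,f^j)_{j\in\mathbb N}\subseteq Z\times\mathcal V\times\mathcal C$: if $(\zeta^j,u^j,f^j)\to(\bar\zeta,\bar u,\bar f)$ in $\tau_1\times\tau_2$, then $Q(E(\bar\zeta,\bar u,\bar f))\le\liminf_j Q(E(\zeta^j,u^j,f^j))$, $S(M\bar u,y^\delta)\le\liminf_j S(Mu^j,y^\delta)$, $R_1(\bar\zeta,\bar u)\le\liminf_j R_1(\zeta^j,u^j)$ and $R_2(\bar f)\le\liminf_j R_2(f^j)$. Let $\gamma(\delta)>0$, $N(\delta)\in\mathbb N$ and $\eta(\delta)\ge0$ be given for $\delta>0$, let $(\zeta^\dagger,u^\dagger,f^\dagger)\in Z\times\mathcal V\times\mathcal C$ satisfy $E(\zeta^\dagger,u^\dagger,f^\dagger)=0$ and $Mu^\dagger=y$, and put $$q_{N(\delta)}:=\inf_{f_N\in\mathcal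 C_{N(\delta)}}\Bigl[Q(E(\zeta^\dagger,u^\dagger,f_N))+\gamma(\delta)\bigl(R_2(f_N)-R_2(f^\dagger)\bigr)\Bigr].$$ Assume: (T4) $q_{N(\delta)}\to0$ as $N(\delta)\to\infty$. (T5) There exists $C>0$ such that, as $\delta\to0$: $\gamma(\delta)\to0$, $\frac{\delta}{\gamma(\delta)}\le C$, $\frac{q_{N(\delta)}}{\gamma(\delta)}\le C$, $\frac{\eta(\delta)}{\gamma(\delta)}\le C$, $N(\delta)\to\infty$ and $\eta(\delta)\to0$. For each $\delta>0$ let $(\zeta^{\gamma(\delta),\delta,N(\delta)},u^{\gamma(\delta),\delta,N(\delta)},f^{\gamma(\delta),\delta,N(\delta)})\in Z\times\mathcal V\times\mathcal C_{N(\delta)}$ be an inexact minimizer, that is, $$T^\delta_{\gamma(\delta)}\bigl(\zeta^{\gamma(\delta),\delta,N(\delta)},u^{\gamma(\delta),\delta,N(\delta)},f^{\gamma(\delta),\delta,N(\delta)}\bigr)\le T^\delta_{\gamma(\delta)}(\zeta,u,f)+\eta(\delta)\qquad\forall(\zeta,u)\in Z\times\mathcal V,\ f\in\mathcal C_{N(\delta)}.$$ Then for every sequence $\delta_j\to0$ ($j\to\infty$), the sequence $(\zeta^{\gamma(\delta_j),\delta_j,N(\delta_j)},u^{\gamma(\delta_j),\delta_j,N(\delta_j)},f^{\gamma(\delta_j),\delta_j,N(\delta_j)})_j$ has a $\tau_1\times\tau_2$-convergent subsequence, and the limit $(\zeta^*,u^*,f^* )$ of every $\tau_1\times\tau_2$-convergent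 subsequence solves the inverse problem, i.e. $E(\zeta^*,u^*,f^* )=0$ and $Mu^*=y$.
   Context: Setting. $X,H,V,W,\mathcal Y$ are Banach spaces, $T>0$, $n\in\mathbb N_0$, $\mathcal V\subseteq L^2(0,T;V)$ (state space) and $\mathcal W\subseteq L^2(0,T;W)$ are Bochner-type spaces, with $V$ a space of functions of $x\in\Omega$. $Z:=X\times H\times\mathbb R^n$ is the parameter space with elements $\zeta=(\lambda,u_0,\alpha)$, and $\mathcal C\subseteq C(\mathbb R^{n+1};\mathbb R)$ is a function space. A function $f\in\mathcal C$ is identified with the Nemitskii operator $[f(\alpha,u)](x,t)=f(\alpha,u(x,t))$, mapping $\mathbb R^n\times\mathcal V\to\mathcal W$. A given map $F:(0,T)\times X\times V\to W$ is identified with $[F(\lambda,u)](t)=F(t,\lambda,u(t))$, mapping $X\times\mathcal V\to\mathcal W$. The model operator is $$E(\zeta,u,f)=\bigl(\dot u-F(\lambda,u)-f(\alpha,u),\ u(0)-u_0\bigr)\in\mathcal W\times H,$$ and $M:\mathcal V\to\mathcal Y$ is the observation operator. $y\in\mathcal Y$ is the exact data and, for each $\delta>0$, $y^\delta\in\mathcal Y$ is noisy data with $0\le S(y,y^\delta)\le\delta$. Functionals: $Q:\mathcal W\times H\to[0,\infty]$ with $Q(w)=0\Leftrightarrow w=0$; $S:\mathcal Y^2\to[0,\infty]$ with $S(y_1,y_2)=0\Leftrightarrow y_1=y_2$ (no triangle inequality is required); $R_1:Z\times\mathcal V\to[0,\infty]$; $R_2:\mathcal C\to[0,\infty]$. For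 $\gamma>0$, $$T_\gamma^\delta(\zeta,u,f):=Q(E(\zeta,u,f))+S(Mu,y^\delta)+\gamma R_1(\zeta,u)+\gamma R_2(f).$$ $\mathcal C_N\subseteq\mathcal C$ is the set of neural networks on $\mathbb R^{n+1}$ with $N$ parameters, that is, functions $A_L\circ\cdots\circ A_1:\mathbb R^{n+1}\to\mathbb R$ with $A_\ell(\mathbf z)=\sigma_\ell(w_\ell\mathbf z+b_\ell)$, $w_\ell\in\mathbb R^{p_\ell\times p_{\ell-1}}$, $b_\ell\in\mathbb R^{p_\ell}$, fixed activations $\sigma_\ell:\mathbb R\to\mathbb R$ applied componentwise, $\sigma_L=\mathrm{Id}$, $p_0=n+1$, $p_L=1$, and $N=\sum_{\ell=1}^L(p_{\ell-1}+1)p_\ell$. No vector space structure on $\mathcal C_N$ is assumed. Sublevel sets of a functional $R$ are the sets $\{R\le c\}$, $c\in\mathbb R$. The definition of $q_{N(\delta)}$ implicitly presupposes $R_2(f^\dagger)<\infty$.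
   Formalization: The formal theorem reads compactness of sublevel sets in (T1) as sequential compactness and additionally assumes R_1(ζ†,u†) < ∞ (and R_2(f†) < ∞, implicit in q); without these a convergent subsequence need not exist. *)

theory Defs
  imports "HOL-Analysis.Analysis"
begin

section \<open>Bochner-Lebesgue spaces on a time interval\<close>

text \<open>
  The library's Bochner integral is restricted to second countable (separable) spaces. As general
  Banach spaces are needed, strong measurability is spelled out: almost everywhere a limit of simple
  functions.
\<close>

definition strongly_measurable :: "'a measure \<Rightarrow> ('a \<Rightarrow> 'b::topological_space) \<Rightarrow> bool" where
  "strongly_measurable M f \<longleftrightarrow>
     (\<exists>s. (\<forall>i. simple_function M (s i)) \<and> (AE t in M. (\<lambda>i::nat. s i t) \<longlonglongrightarrow> f t))"

abbreviation time_measure :: "real \<Rightarrow> real measure" where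
  "time_measure T \<equiv> lebesgue_on {0<..<T}"

definition L2_fun :: "real \<Rightarrow> (real \<Rightarrow> 'b::real_normed_vector) set" where
  "L2_fun T = {f. strongly_measurable (time_measure T) f \<and>
                  (\<integral>\<^sup>+ t. ennreal ((norm (f t))\<^sup>2) \<partial>time_measure T) < \<infinity>}"

text \<open>
  Elements of \<open>L\<^sup>2(0,T;B)\<close> are equivalence classes, i.e. sets of functions that agree almost
  everywhere. All operators below return the set of all square integrable functions that are
  a version of the result; this set is a class if the result exists in \<open>L\<^sup>2\<close>, and it is empty
  otherwise. Hence membership of the value in a subset of \<open>L\<^sup>2(0,T;B)\<close> includes its existence.
\<close>

definition L2_class :: "real \<Rightarrow> (real \<Rightarrow> 'b::real_normed_vector) \<Rightarrow> (real \<Rightarrow> 'b) set" where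
  "L2_class T f = {g \<in> L2_fun T. AE t in time_measure T. g t = f t}"

definition L2_space :: "real \<Rightarrow> (real \<Rightarrow> 'b::real_normed_vector) set set" where
  "L2_space T = L2_class T ` L2_fun T"

definition L2_zero :: "real \<Rightarrow> (real \<Rightarrow> 'b::real_normed_vector) set" where
  "L2_zero T = L2_class T (\<lambda>_. 0)"

definition L2_lincomb ::
  "real \<Rightarrow> real \<Rightarrow> (real \<Rightarrow> 'b::real_normed_vector) set \<Rightarrow> real \<Rightarrow> (real \<Rightarrow> 'b) set \<Rightarrow> (real \<Rightarrow> 'b) set"
where
  "L2_lincomb T c a d b =
     {g \<in> L2_fun T. \<exists>f\<in>a. \<exists>h\<in>b. AE t in time_measure T. g t = c *\<^sub>R f t + d *\<^sub>R h t}"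

definition L2_diff ::
  "real \<Rightarrow> (real \<Rightarrow> 'b::real_normed_vector) set \<Rightarrow> (real \<Rightarrow> 'b) set \<Rightarrow> (real \<Rightarrow> 'b) set" where
  "L2_diff T a b = L2_lincomb T 1 a (-1) b"

definition L2_subspace :: "real \<Rightarrow> (real \<Rightarrow> 'b::real_normed_vector) set set \<Rightarrow> bool" where
  "L2_subspace T S \<longleftrightarrow> S \<subseteq> L2_space T \<and> L2_zero T \<in> S \<and>
     (\<forall>a\<in>S. \<forall>b\<in>S. \<forall>c d. L2_lincomb T c a d b \<in> S)"


section \<open>The model operator\<close>

text \<open>
  The spaces \<open>V\<close>, \<open>H\<close>, \<open>W\<close> are continuously embedded, by \<open>iV\<close>, \<open>iH\<close>, \<open>iW\<close>, into a common Banach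
  space; this gives a meaning to a \<open>W\<close>-valued time derivative and an \<open>H\<close>-valued initial value of a
  \<open>V\<close>-valued function.
\<close>

definition embedding :: "('a::real_normed_vector \<Rightarrow> 'e::real_normed_vector) \<Rightarrow> bool" where
  "embedding i \<longleftrightarrow> bounded_linear i \<and> inj i"

definition test_functions :: "real \<Rightarrow> (real \<Rightarrow> real) set" where
  "test_functions T = {\<phi>. (\<forall>k. (deriv ^^ k) \<phi> differentiable_on UNIV) \<and>
                          closure {t. \<phi> t \<noteq> 0} \<subseteq> {0<..<T}}"

text \<open>
  The integrals are Henstock-Kurzweil integrals; on the Bochner integrable functions to which they
  are applied, they agree with the Bochner integral.
\<close>

definition has_weak_derivative :: "real \<Rightarrow> (real \<Rightarrow> 'e::banach) \<Rightarrow> (real \<Rightarrow> 'e) \<Rightarrow> bool" where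
  "has_weak_derivative T u g \<longleftrightarrow>
     (\<forall>\<phi>\<in>test_functions T.
        integral {0..T} (\<lambda>t. deriv \<phi> t *\<^sub>R u t) = - integral {0..T} (\<lambda>t. \<phi> t *\<^sub>R g t))"

definition time_derivative ::
  "real \<Rightarrow> ('v::banach \<Rightarrow> 'e::banach) \<Rightarrow> ('w::banach \<Rightarrow> 'e) \<Rightarrow> (real \<Rightarrow> 'v) set \<Rightarrow> (real \<Rightarrow> 'w) set" where
  "time_derivative T iV iW u =
     {g \<in> L2_fun T. \<exists>v\<in>u. has_weak_derivative T (\<lambda>t. iV (v t)) (\<lambda>t. iW (g t))}"

definition has_initial_value ::
  "real \<Rightarrow> ('v::banach \<Rightarrow> 'e::banach) \<Rightarrow> ('h::banach \<Rightarrow> 'e) \<Rightarrow> (real \<Rightarrow> 'v) set \<Rightarrow> 'h \<Rightarrow> bool" where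
  "has_initial_value T iV iH u h \<longleftrightarrow>
     (\<exists>v\<in>u. \<exists>c. continuous_on {0..T} c \<and> (AE t in time_measure T. c t = iV (v t)) \<and> c 0 = iH h)"

definition initial_value ::
  "real \<Rightarrow> ('v::banach \<Rightarrow> 'e::banach) \<Rightarrow> ('h::banach \<Rightarrow> 'e) \<Rightarrow> (real \<Rightarrow> 'v) set \<Rightarrow> 'h" where
  "initial_value T iV iH u = (THE h. has_initial_value T iV iH u h)"

text \<open>
  \<open>emb\<close> partially identifies real functions on \<open>\<Omega>\<close> (typically modulo null sets) with elements of the
  ambient space, and \<open>ev v\<close> is \<open>v \<in> V\<close> as a function on \<open>\<Omega>\<close> (typically a representative).
\<close>

definition function_space ::
  "'p set \<Rightarrow> (('p \<Rightarrow> real) \<rightharpoonup> 'e::real_vector) \<Rightarrow> ('v \<Rightarrow> 'p \<Rightarrow> real) \<Rightarrow> ('v \<Rightarrow> 'e) \<Rightarrow> bool" where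
  "function_space \<Omega> emb ev iV \<longleftrightarrow>
     (\<forall>g a h b c d. emb g = Some a \<longrightarrow> emb h = Some b \<longrightarrow>
        emb (\<lambda>x\<in>\<Omega>. c * g x + d * h x) = Some (c *\<^sub>R a + d *\<^sub>R b)) \<and>
     (\<forall>v. emb (\<lambda>x\<in>\<Omega>. ev v x) = Some (iV v))"

text \<open>
  \<open>\<real>\<^sup>n\<close> is \<open>topspace (Euclidean_space n)\<close>, the sequences vanishing from index \<open>n\<close> on, so
  \<open>\<alpha>(n := s)\<close> is the point \<open>(\<alpha>, s)\<close> of \<open>\<real>\<^sup>n\<^sup>+\<^sup>1\<close>. Functions on \<open>\<real>\<^sup>n\<^sup>+\<^sup>1\<close> are taken to be extensional, so
  that equality means equality on \<open>\<real>\<^sup>n\<^sup>+\<^sup>1\<close>.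
\<close>

definition continuous_functions :: "nat \<Rightarrow> ((nat \<Rightarrow> real) \<Rightarrow> real) set" where
  "continuous_functions m = {f \<in> extensional (topspace (Euclidean_space m)).
                               continuous_map (Euclidean_space m) euclideanreal f}"

definition nemytskii ::
  "real \<Rightarrow> 'p set \<Rightarrow> (('p \<Rightarrow> real) \<rightharpoonup> 'e::banach) \<Rightarrow> ('v::banach \<Rightarrow> 'p \<Rightarrow> real) \<Rightarrow> ('w::banach \<Rightarrow> 'e) \<Rightarrow>
   nat \<Rightarrow> ((nat \<Rightarrow> real) \<Rightarrow> real) \<Rightarrow> (nat \<Rightarrow> real) \<Rightarrow> (real \<Rightarrow> 'v) set \<Rightarrow> (real \<Rightarrow> 'w) set" where
  "nemytskii T \<Omega> emb ev iW n f \<alpha> u =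
     {g \<in> L2_fun T. \<exists>v\<in>u. AE t in time_measure T.
        emb (\<lambda>x\<in>\<Omega>. f (\<alpha>(n := ev (v t) x))) = Some (iW (g t))}"

definition known_term ::
  "real \<Rightarrow> (real \<Rightarrow> 'x \<Rightarrow> 'v::banach \<Rightarrow> 'w::banach) \<Rightarrow> 'x \<Rightarrow> (real \<Rightarrow> 'v) set \<Rightarrow> (real \<Rightarrow> 'w) set" where
  "known_term T F lam u =
     {g \<in> L2_fun T. \<exists>v\<in>u. AE t in time_measure T. g t = F t lam (v t)}"

definition parameter_space :: "nat \<Rightarrow> ('x \<times> 'h \<times> (nat \<Rightarrow> real)) set" where
  "parameter_space n = UNIV \<times> UNIV \<times> topspace (Euclidean_space n)"

definition model_operator ::
  "real \<Rightarrow> 'p set \<Rightarrow> (('p \<Rightarrow> real) \<rightharpoonup> 'e::banach) \<Rightarrow> ('v::banach \<Rightarrow> 'p \<Rightarrow> real) \<Rightarrow>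
   ('v \<Rightarrow> 'e) \<Rightarrow> ('h::banach \<Rightarrow> 'e) \<Rightarrow> ('w::banach \<Rightarrow> 'e) \<Rightarrow> nat \<Rightarrow> (real \<Rightarrow> 'x \<Rightarrow> 'v \<Rightarrow> 'w) \<Rightarrow>
   'x \<times> 'h \<times> (nat \<Rightarrow> real) \<Rightarrow> (real \<Rightarrow> 'v) set \<Rightarrow> ((nat \<Rightarrow> real) \<Rightarrow> real) \<Rightarrow> (real \<Rightarrow> 'w) set \<times> 'h" where
  "model_operator T \<Omega> emb ev iV iH iW n F = (\<lambda>(lam, u0, \<alpha>) u f.
     (L2_diff T (L2_diff T (time_derivative T iV iW u) (known_term T F lam u))
                (nemytskii T \<Omega> emb ev iW n f \<alpha> u),
      initial_value T iV iH u - u0))"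


section \<open>Neural networks\<close>

definition affine_layer ::
  "(real \<Rightarrow> real) \<Rightarrow> (nat \<Rightarrow> nat \<Rightarrow> real) \<Rightarrow> (nat \<Rightarrow> real) \<Rightarrow> nat \<Rightarrow> nat \<Rightarrow> (nat \<Rightarrow> real) \<Rightarrow> (nat \<Rightarrow> real)"
where
  "affine_layer s w b p q z = (\<lambda>i. if i < q then s ((\<Sum>j<p. w i j * z j) + b i) else 0)"

primrec layers ::
  "(nat \<Rightarrow> real \<Rightarrow> real) \<Rightarrow> (nat \<Rightarrow> nat \<Rightarrow> nat \<Rightarrow> real) \<Rightarrow> (nat \<Rightarrow> nat \<Rightarrow> real) \<Rightarrow> (nat \<Rightarrow> nat) \<Rightarrow>
   nat \<Rightarrow> (nat \<Rightarrow> real) \<Rightarrow> (nat \<Rightarrow> real)" where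
  "layers \<sigma> w b p 0 z = z"
| "layers \<sigma> w b p (Suc l) z =
     affine_layer (\<sigma> (Suc l)) (w (Suc l)) (b (Suc l)) (p l) (p (Suc l)) (layers \<sigma> w b p l z)"

text \<open>Depth and widths are arbitrary, subject to the number of parameters being \<open>N\<close>.\<close>

definition neural_networks ::
  "(nat \<Rightarrow> real \<Rightarrow> real) \<Rightarrow> nat \<Rightarrow> nat \<Rightarrow> ((nat \<Rightarrow> real) \<Rightarrow> real) set" where
  "neural_networks \<sigma> n N =
     {(\<lambda>z\<in>topspace (Euclidean_space (Suc n)). layers (\<sigma>(L := id)) w b p L z 0) | L p w b.
        L \<ge> 1 \<and> p 0 = Suc n \<and> p L = 1 \<and> (\<forall>l\<in>{1..L}. p l \<ge> 1) \<and>
        N = (\<Sum>l = 1..L. (p (l - 1) + 1) * p l)}"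


section \<open>Sequential compactness and the Tikhonov functional\<close>

text \<open>In a general topological space, neither this notion nor \<open>compactin\<close> implies the other.\<close>

definition seq_compactin :: "'a topology \<Rightarrow> 'a set \<Rightarrow> bool" where
  "seq_compactin X K \<longleftrightarrow> K \<subseteq> topspace X \<and>
     (\<forall>s :: nat \<Rightarrow> 'a. range s \<subseteq> K \<longrightarrow>
        (\<exists>l\<in>K. \<exists>r :: nat \<Rightarrow> nat. strict_mono r \<and> limitin X (s \<circ> r) l sequentially))"

definition tikhonov ::
  "('r \<Rightarrow> ennreal) \<Rightarrow> ('z \<Rightarrow> 'u \<Rightarrow> 'f \<Rightarrow> 'r) \<Rightarrow> ('y \<Rightarrow> 'y \<Rightarrow> ennreal) \<Rightarrow> ('u \<Rightarrow> 'y) \<Rightarrow>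
   ('z \<times> 'u \<Rightarrow> ennreal) \<Rightarrow> ('f \<Rightarrow> ennreal) \<Rightarrow> real \<Rightarrow> 'y \<Rightarrow> 'z \<Rightarrow> 'u \<Rightarrow> 'f \<Rightarrow> ennreal" where
  "tikhonov Q E S M R1 R2 g y z u f =
     Q (E z u f) + S (M u) y + ennreal g * R1 (z, u) + ennreal g * R2 f"

end

theory Submission
  imports Defs
begin

text \<open>
  For every network \<open>f\<close>, the triple \<open>(\<zeta>\<^sup>\<dagger>, u\<^sup>\<dagger>, f)\<close> is admissible in the minimality condition, and as
  \<open>M u\<^sup>\<dagger> = y\<close> its data misfit is at most \<open>\<delta>\<close>. Taking the infimum over \<open>f\<close> turns the remaining terms
  into \<open>q\<close>, up to the constant \<open>\<gamma> R\<^sub>2(f\<^sup>\<dagger>)\<close>; thus the Tikhonov functional at the inexact minimizer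
  is at most \<open>q + \<delta> + \<eta> + \<gamma> R\<^sub>1(\<zeta>\<^sup>\<dagger>, u\<^sup>\<dagger>) + \<gamma> R\<^sub>2(f\<^sup>\<dagger>)\<close>. For small \<open>\<delta>\<close>, each of \<open>q\<close>,
  \<open>\<delta>\<close> and \<open>\<eta>\<close> is at most \<open>C \<gamma>\<close>, so this is at most \<open>K \<gamma>\<close> with a constant \<open>K\<close> (\<open>tikhonov_inexact_minimizer_le\<close>).

  Everything follows from this one inequality. Dividing by \<open>\<gamma>\<close> bounds both regularizers by \<open>K\<close>, so
  that the minimizers eventually lie in sublevel sets, whose sequential compactness gives the
  convergent subsequence (\<open>eventually_in_seq_compactin_prod\<close>). Letting \<open>\<gamma> \<rightarrow> 0\<close>
  shows that the model residual and the data misfit tend to zero, and the closedness of the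
  equations \<open>E = 0\<close> and \<open>M u = y\<close> carries this over to every limit.
\<close>

text \<open>
  The difference \<open>R\<^sub>2(f) - R\<^sub>2(f\<^sup>\<dagger>)\<close> lives in the extended reals, where adding back
  \<open>\<gamma> R\<^sub>2(f\<^sup>\<dagger>)\<close> is harmless because this number is finite; \<open>r0\<close> stands for \<open>R\<^sub>2(f\<^sup>\<dagger>)\<close>.
  Candidates with an infinite value satisfy the comparison trivially, and
  it is the bound on the infimum that makes \<open>t\<close> finite.
\<close>

lemma tikhonov_inexact_minimizer_le:
  fixes t r0 :: ennreal and g \<delta> \<eta> C :: real
  assumes g: "g > 0" and \<delta>: "\<delta> \<ge> 0" and \<eta>: "\<eta> \<ge> 0"
    and r: "R1 (z, u) < \<infinity>" and r0: "r0 < \<infinity>" and s: "S (M u) y \<le> ennreal \<delta>"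
    and rates: "\<delta> / g \<le> C" "\<eta> / g \<le> C"
    and inf: "(INF f\<in>A. enn2ereal (Q (E z u f)) +
                 ereal g * (enn2ereal (R2 f) - enn2ereal r0)) / ereal g \<le> ereal C"
    and t: "\<And>f. f \<in> A \<Longrightarrow> t \<le> tikhonov Q E S M R1 R2 g y z u f + ennreal \<eta>"
  shows "t \<le> ennreal g * ennreal (3 * C + enn2real (R1 (z, u)) + enn2real r0)"
proof -
  define I where "I = (INF f\<in>A. enn2ereal (Q (E z u f)) +
                        ereal g * (enn2ereal (R2 f) - enn2ereal r0))"
  define \<rho> \<rho>0 where "\<rho> = enn2real (R1 (z, u))" and "\<rho>0 = enn2real r0"
  have \<rho>: "R1 (z, u) = ennreal \<rho>" "\<rho> \<ge> 0" and \<rho>0: "r0 = ennreal \<rho>0" "\<rho>0 \<ge> 0"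
    using r r0 by (auto simp: \<rho>_def \<rho>0_def)
  define c where "c = g * \<rho>0 + \<delta> + g * \<rho> + \<eta>"
  have "enn2ereal t - ereal c \<le> I"
    unfolding I_def
  proof (rule INF_greatest)
    fix f assume f: "f \<in> A"
    let ?a = "Q (E z u f)" and ?b = "R2 f"
    have le: "t \<le> ?a + ennreal \<delta> + ennreal g * ennreal \<rho> + ennreal g * ?b + ennreal \<eta>"
      using order_trans[OF t[OF f]] s unfolding tikhonov_def \<rho>
      by (metis (no_types, lifting) add_mono order_refl)
    show "enn2ereal t - ereal c \<le> enn2ereal ?a + ereal g * (enn2ereal ?b - enn2ereal r0)"
    proof (cases "?a = \<infinity> \<or> ?b = \<infinity>")
      case True
      then show ?thesis
        using g \<rho>0 by (cases ?a; cases ?b) (auto simp: enn2ereal_ennreal)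
    next
      case False
      then obtain a b where ab: "?a = ennreal a" "a \<ge> 0" "?b = ennreal b" "b \<ge> 0"
        by (cases ?a; cases ?b) auto
      with le have le': "t \<le> ennreal (a + \<delta> + g * \<rho> + g * b + \<eta>)"
        using g \<delta> \<eta> \<rho> by (simp add: ennreal_mult ennreal_plus)
      then obtain t' where t': "t = ennreal t'" "t' \<ge> 0"
        by (cases t) (auto simp: top_unique)
      have "t' \<le> a + \<delta> + g * \<rho> + g * b + \<eta>"
        using le' ab g \<delta> \<eta> \<rho> unfolding t'(1) by (subst (asm) ennreal_le_iff) simp_all
      then show ?thesis
        using t' ab \<rho>0 by (simp add: enn2ereal_ennreal c_def algebra_simps)
    qed
  qed
  moreover have "I \<le> ereal (C * g)"
    using inf g unfolding I_def[symmetric] by (cases I) (auto simp: field_simps)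
  ultimately have "enn2ereal t - ereal c \<le> ereal (C * g)"
    by (rule order_trans)
  then obtain t' where t': "t = ennreal t'" "t' \<ge> 0" "t' \<le> C * g + c"
    by (cases t) (auto simp: enn2ereal_ennreal)
  have "c \<le> g * (2 * C + \<rho> + \<rho>0)"
    using rates g by (simp add: c_def field_simps)
  then have "t' \<le> g * (3 * C + \<rho> + \<rho>0)"
    using t'(3) by (simp add: algebra_simps)
  then show ?thesis
    using t' g by (simp add: \<rho>_def \<rho>0_def ennreal_mult'[symmetric] ennreal_leI)
qed

text \<open>
  Sequential compactness of each factor suffices here: a subsequence that converges in the first
  factor is refined to one that converges in the second. The first \<open>J\<close>
  terms, which may lie outside \<open>K \<times> L\<close>, are skipped by a shift.
\<close>

lemma eventually_in_seq_compactin_prod: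
  assumes K: "seq_compactin X K" and L: "seq_compactin Y L"
    and a: "\<forall>\<^sub>F j in sequentially. a j \<in> K" and b: "\<forall>\<^sub>F j in sequentially. b j \<in> L"
  shows "\<exists>r l. strict_mono r \<and>
           limitin (prod_topology X Y) (\<lambda>j::nat. (a (r j), b (r j))) l sequentially"
proof -
  obtain J where J: "\<And>j. j \<ge> J \<Longrightarrow> a j \<in> K \<and> b j \<in> L"
    using eventually_conj[OF a b] unfolding eventually_sequentially by blast
  have "range (\<lambda>j. a (j + J)) \<subseteq> K"
    using J by auto
  then obtain l r where r: "strict_mono r" "limitin X ((\<lambda>j. a (j + J)) \<circ> r) l sequentially"
    using K unfolding seq_compactin_def by blast
  have "range (\<lambda>j. b (r j + J)) \<subseteq> L"
    using J by auto
  then obtain m r' where r': "strict_mono r'" "limitin Y ((\<lambda>j. b (r j + J)) \<circ> r') m sequentially"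
    using L unfolding seq_compactin_def by blast
  have "limitin X (((\<lambda>j. a (j + J)) \<circ> r) \<circ> r') l sequentially"
    by (rule limitin_subsequence[OF r'(1) r(2)])
  then have "limitin (prod_topology X Y) (\<lambda>j. (a (r (r' j) + J), b (r (r' j) + J))) (l, m) sequentially"
    using r'(2) by (simp add: limitin_pairwise o_def)
  moreover have "strict_mono (\<lambda>j. r (r' j) + J)"
    using r(1) r'(1) by (simp add: strict_mono_def)
  ultimately show ?thesis
    by blast
qed

lemma L2_diff_in_subspace:
  "\<lbrakk>L2_subspace T B; a \<in> B; b \<in> B\<rbrakk> \<Longrightarrow> L2_diff T a b \<in> B"
  by (simp add: L2_subspace_def L2_diff_def)

theorem proposition2:
  fixes T :: real and n :: nat
    and \<Omega> :: "'p set"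
    and emb :: "('p \<Rightarrow> real) \<rightharpoonup> 'e::banach"
    and ev :: "'v::banach \<Rightarrow> 'p \<Rightarrow> real"
    and iV :: "'v \<Rightarrow> 'e" and iH :: "'h::banach \<Rightarrow> 'e" and iW :: "'w::banach \<Rightarrow> 'e"
    and VV :: "(real \<Rightarrow> 'v) set set" and WW :: "(real \<Rightarrow> 'w) set set"
    and CC :: "((nat \<Rightarrow> real) \<Rightarrow> real) set"
    and Z :: "('x::banach \<times> 'h \<times> (nat \<Rightarrow> real)) set"
    and F :: "real \<Rightarrow> 'x \<Rightarrow> 'v \<Rightarrow> 'w"
    and E :: "'x \<times> 'h \<times> (nat \<Rightarrow> real) \<Rightarrow> (real \<Rightarrow> 'v) set \<Rightarrow> ((nat \<Rightarrow> real) \<Rightarrow> real) \<Rightarrow>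
              (real \<Rightarrow> 'w) set \<times> 'h"
    and M :: "(real \<Rightarrow> 'v) set \<Rightarrow> 'y::banach"
    and y :: 'y and yd :: "real \<Rightarrow> 'y"
    and Q :: "(real \<Rightarrow> 'w) set \<times> 'h \<Rightarrow> ennreal"
    and S :: "'y \<Rightarrow> 'y \<Rightarrow> ennreal"
    and R1 :: "('x \<times> 'h \<times> (nat \<Rightarrow> real)) \<times> (real \<Rightarrow> 'v) set \<Rightarrow> ennreal"
    and R2 :: "((nat \<Rightarrow> real) \<Rightarrow> real) \<Rightarrow> ennreal"
    and \<sigma> :: "nat \<Rightarrow> real \<Rightarrow> real"
    and \<tau>1 :: "(('x \<times> 'h \<times> (nat \<Rightarrow> real)) \<times> (real \<Rightarrow> 'v) set) topology"
    and \<tau>2 :: "((nat \<Rightarrow> real) \<Rightarrow> real) topology"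
    and \<gamma> \<eta> :: "real \<Rightarrow> real" and N :: "real \<Rightarrow> nat" and q :: "real \<Rightarrow> ereal"
    and zdag :: "'x \<times> 'h \<times> (nat \<Rightarrow> real)" and udag :: "(real \<Rightarrow> 'v) set"
    and fdag :: "(nat \<Rightarrow> real) \<Rightarrow> real"
    and zm :: "real \<Rightarrow> 'x \<times> 'h \<times> (nat \<Rightarrow> real)" and um :: "real \<Rightarrow> (real \<Rightarrow> 'v) set"
    and fm :: "real \<Rightarrow> (nat \<Rightarrow> real) \<Rightarrow> real"
  assumes T: "T > 0"
    and embeddings: "embedding iV" "embedding iH" "embedding iW" "function_space \<Omega> emb ev iV"
    and VV: "L2_subspace T VV" and WW: "L2_subspace T WW"
    and CC: "CC \<subseteq> continuous_functions (Suc n)"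
    and CN: "\<forall>k. neural_networks \<sigma> n k \<subseteq> CC"
    and Z: "Z = parameter_space n"
    and derivative: "\<forall>u\<in>VV. time_derivative T iV iW u \<in> WW"
    and initial: "\<forall>u\<in>VV. \<exists>h. has_initial_value T iV iH u h"
    and known: "\<forall>lam. \<forall>u\<in>VV. known_term T F lam u \<in> WW"
    and nemytskii: "\<forall>f\<in>CC. \<forall>\<alpha>\<in>topspace (Euclidean_space n). \<forall>u\<in>VV.
                      nemytskii T \<Omega> emb ev iW n f \<alpha> u \<in> WW"
    and E: "E = model_operator T \<Omega> emb ev iV iH iW n F"
    and Q: "\<forall>w\<in>WW. \<forall>h. Q (w, h) = 0 \<longleftrightarrow> w = L2_zero T \<and> h = 0"
    and S: "\<forall>y1 y2. S y1 y2 = 0 \<longleftrightarrow> y1 = y2"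
    and noise: "\<forall>\<delta>>0. S y (yd \<delta>) \<le> ennreal \<delta>"
    and top: "topspace \<tau>1 = Z \<times> VV" "topspace \<tau>2 = CC"
    and T1: "\<forall>c::real. seq_compactin \<tau>1 {p \<in> Z \<times> VV. enn2ereal (R1 p) \<le> ereal c}"
            "\<forall>c::real. seq_compactin \<tau>2 {f \<in> CC. enn2ereal (R2 f) \<le> ereal c}"
    and T2: "\<forall>zj uj fj yj z' u' f'.
        (\<forall>j::nat. zj j \<in> Z \<and> uj j \<in> VV \<and> fj j \<in> CC) \<longrightarrow>
        limitin (prod_topology \<tau>1 \<tau>2) (\<lambda>j. ((zj j, uj j), fj j)) ((z', u'), f') sequentially \<longrightarrow>
        (\<lambda>j. Q (E (zj j) (uj j) (fj j))) \<longlonglongrightarrow> 0 \<longrightarrow>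
        (\<lambda>j. S (M (uj j)) (yj j)) \<longlonglongrightarrow> 0 \<longrightarrow>
        (\<lambda>j. S y (yj j)) \<longlonglongrightarrow> 0 \<longrightarrow>
        Q (E z' u' f') = 0 \<and> S (M u') y = 0"
    and T3: "\<forall>zj uj fj z' u' f'.
        (\<forall>j::nat. zj j \<in> Z \<and> uj j \<in> VV \<and> fj j \<in> CC) \<longrightarrow>
        limitin (prod_topology \<tau>1 \<tau>2) (\<lambda>j. ((zj j, uj j), fj j)) ((z', u'), f') sequentially \<longrightarrow>
        Q (E z' u' f') \<le> liminf (\<lambda>j. Q (E (zj j) (uj j) (fj j))) \<and>
        (\<forall>\<delta>>0. S (M u') (yd \<delta>) \<le> liminf (\<lambda>j. S (M (uj j)) (yd \<delta>))) \<and>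
        R1 (z', u') \<le> liminf (\<lambda>j. R1 (zj j, uj j)) \<and>
        R2 f' \<le> liminf (\<lambda>j. R2 (fj j))"
    and parameters: "\<forall>\<delta>>0. \<gamma> \<delta> > 0 \<and> \<eta> \<delta> \<ge> 0"
    and dag: "zdag \<in> Z" "udag \<in> VV" "fdag \<in> CC" "E zdag udag fdag = (L2_zero T, 0)" "M udag = y"
    and dag_finite: "R1 (zdag, udag) < \<infinity>" "R2 fdag < \<infinity>"
    and q: "\<forall>\<delta>>0. q \<delta> = (INF f \<in> neural_networks \<sigma> n (N \<delta>).
              enn2ereal (Q (E zdag udag f)) +
              ereal (\<gamma> \<delta>) * (enn2ereal (R2 f) - enn2ereal (R2 fdag)))"
    and T4: "(q \<longlongrightarrow> 0) (at_right 0)"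
    and T5: "\<exists>C>0. (\<gamma> \<longlongrightarrow> 0) (at_right 0) \<and>
               (\<forall>\<^sub>F \<delta> in at_right 0. \<delta> / \<gamma> \<delta> \<le> C) \<and>
               (\<forall>\<^sub>F \<delta> in at_right 0. q \<delta> / ereal (\<gamma> \<delta>) \<le> ereal C) \<and>
               (\<forall>\<^sub>F \<delta> in at_right 0. \<eta> \<delta> / \<gamma> \<delta> \<le> C) \<and>
               filterlim N at_top (at_right 0) \<and>
               (\<eta> \<longlongrightarrow> 0) (at_right 0)"
    and minimizer: "\<forall>\<delta>>0. zm \<delta> \<in> Z \<and> um \<delta> \<in> VV \<and> fm \<delta> \<in> neural_networks \<sigma> n (N \<delta>) \<and>
        (\<forall>z\<in>Z. \<forall>u\<in>VV. \<forall>f\<in>neural_networks \<sigma> n (N \<delta>).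
           tikhonov Q E S M R1 R2 (\<gamma> \<delta>) (yd \<delta>) (zm \<delta>) (um \<delta>) (fm \<delta>)
             \<le> tikhonov Q E S M R1 R2 (\<gamma> \<delta>) (yd \<delta>) z u f + ennreal (\<eta> \<delta>))"
  shows "\<forall>\<delta>j :: nat \<Rightarrow> real. (\<forall>j. \<delta>j j > 0) \<and> \<delta>j \<longlonglongrightarrow> 0 \<longrightarrow>
      (\<exists>r l. strict_mono r \<and>
         limitin (prod_topology \<tau>1 \<tau>2)
           (\<lambda>j. ((zm (\<delta>j (r j)), um (\<delta>j (r j))), fm (\<delta>j (r j)))) l sequentially) \<and>
      (\<forall>r z' u' f'. strict_mono r \<longrightarrow>
         limitin (prod_topology \<tau>1 \<tau>2)
           (\<lambda>j. ((zm (\<delta>j (r j)), um (\<delta>j (r j))), fm (\<delta>j (r j)))) ((z', u'), f') sequentially \<longrightarrow>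
         E z' u' f' = (L2_zero T, 0) \<and> M u' = y)"
proof (intro allI impI conjI)
  fix \<delta>j :: "nat \<Rightarrow> real"
  assume "(\<forall>j. \<delta>j j > 0) \<and> \<delta>j \<longlonglongrightarrow> 0"
  then have pos: "\<And>j. \<delta>j j > 0" and lim: "\<delta>j \<longlonglongrightarrow> 0"
    by auto
  have at_right: "filterlim \<delta>j (at_right 0) sequentially"
    using pos lim by (simp add: filterlim_at less_imp_neq[symmetric])
  obtain C where C: "C > 0" and \<gamma>0: "(\<gamma> \<longlongrightarrow> 0) (at_right 0)"
    and rates: "\<forall>\<^sub>F \<delta> in at_right 0. \<delta> / \<gamma> \<delta> \<le> C" "\<forall>\<^sub>F \<delta> in at_right 0. \<eta> \<delta> / \<gamma> \<delta> \<le> C"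
      "\<forall>\<^sub>F \<delta> in at_right 0. q \<delta> / ereal (\<gamma> \<delta>) \<le> ereal C"
    using T5 by blast
  \<comment> \<open>One \<open>C\<close> for each of \<open>q\<close>, \<open>\<delta>\<close> and \<open>\<eta>\<close>.\<close>
  define K where "K = 3 * C + enn2real (R1 (zdag, udag)) + enn2real (R2 fdag)"
  define tm where "tm \<delta> = tikhonov Q E S M R1 R2 (\<gamma> \<delta>) (yd \<delta>) (zm \<delta>) (um \<delta>) (fm \<delta>)" for \<delta>
  have "\<forall>\<^sub>F \<delta> in at_right 0. tm \<delta> \<le> ennreal (\<gamma> \<delta>) * ennreal K"
    using rates eventually_at_right_less[of 0]
  proof eventually_elim
    case (elim \<delta>)
    then show ?case
      unfolding K_def tm_def
      using parameters C dag dag_finite noise q minimizer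
      by (intro tikhonov_inexact_minimizer_le[where A = "neural_networks \<sigma> n (N \<delta>)"
            and \<delta> = \<delta> and \<eta> = "\<eta> \<delta>" and Q = Q and E = E and S = S and M = M and y = "yd \<delta>"
            and ?R1.0 = R1 and ?R2.0 = R2]) auto
  qed
  then have bound: "\<forall>\<^sub>F j in sequentially. tm (\<delta>j j) \<le> ennreal (\<gamma> (\<delta>j j)) * ennreal K"
    using at_right by (rule eventually_compose_filterlim)
  have in_spaces: "zm (\<delta>j j) \<in> Z" "um (\<delta>j j) \<in> VV" "fm (\<delta>j j) \<in> CC" for j
    using minimizer CN pos by blast+

  show "\<exists>r l. strict_mono r \<and> limitin (prod_topology \<tau>1 \<tau>2)
           (\<lambda>j. ((zm (\<delta>j (r j)), um (\<delta>j (r j))), fm (\<delta>j (r j)))) l sequentially"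
  proof (rule eventually_in_seq_compactin_prod)
    have cancel: "x \<le> ennreal K"
      if "tm (\<delta>j j) \<le> ennreal (\<gamma> (\<delta>j j)) * ennreal K" "ennreal (\<gamma> (\<delta>j j)) * x \<le> tm (\<delta>j j)" for j x
      using order_trans[OF that(2,1)] parameters pos
      by (subst (asm) ennreal_mult_le_mult_iff) (auto simp: less_imp_neq[symmetric])
    have K: "enn2ereal x \<le> ereal K" if "x \<le> ennreal K" for x
    proof -
      have "K \<ge> 0"
        using C by (simp add: K_def)
      then show ?thesis
        using that by (metis enn2ereal_ennreal less_eq_ennreal.rep_eq)
    qed
    show "\<forall>\<^sub>F j in sequentially. (zm (\<delta>j j), um (\<delta>j j)) \<in> {p \<in> Z \<times> VV. enn2ereal (R1 p) \<le> ereal K}"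
      using bound
    proof eventually_elim
      case (elim j)
      have "ennreal (\<gamma> (\<delta>j j)) * R1 (zm (\<delta>j j), um (\<delta>j j)) \<le> tm (\<delta>j j)"
        by (auto simp: tm_def tikhonov_def intro: add_increasing add_increasing2)
      then show ?case
        using cancel[OF elim] K in_spaces by simp
    qed
    show "\<forall>\<^sub>F j in sequentially. fm (\<delta>j j) \<in> {f \<in> CC. enn2ereal (R2 f) \<le> ereal K}"
      using bound
    proof eventually_elim
      case (elim j)
      have "ennreal (\<gamma> (\<delta>j j)) * R2 (fm (\<delta>j j)) \<le> tm (\<delta>j j)"
        by (auto simp: tm_def tikhonov_def intro: add_increasing)
      then show ?case
        using cancel[OF elim] K in_spaces by simp
    qed
  qed (use T1 in auto)

  fix r :: "nat \<Rightarrow> nat" and z' u' f'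
  assume r: "strict_mono r"
    and l: "limitin (prod_topology \<tau>1 \<tau>2)
         (\<lambda>j. ((zm (\<delta>j (r j)), um (\<delta>j (r j))), fm (\<delta>j (r j)))) ((z', u'), f') sequentially"
  have sub: "filterlim (\<lambda>j. \<delta>j (r j)) (at_right 0) sequentially"
    by (rule filterlim_compose[OF at_right filterlim_subseq[OF r]])
  have "(\<lambda>j. ennreal (\<gamma> (\<delta>j j)) * ennreal K) \<longlonglongrightarrow> ennreal 0 * ennreal K"
    by (intro tendsto_mult_ennreal tendsto_ennrealI filterlim_compose[OF \<gamma>0 at_right] tendsto_const)
      auto
  then have "(\<lambda>j. tm (\<delta>j j)) \<longlonglongrightarrow> 0"
    by (intro tendsto_sandwich[OF _ bound tendsto_const]) auto
  then have tm0: "(\<lambda>j. tm (\<delta>j (r j))) \<longlonglongrightarrow> 0"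
    using filterlim_compose filterlim_subseq[OF r] by blast
  have "(\<lambda>j. Q (E (zm (\<delta>j (r j))) (um (\<delta>j (r j))) (fm (\<delta>j (r j))))) \<longlonglongrightarrow> 0"
    by (rule tendsto_sandwich[OF _ _ tendsto_const tm0])
      (auto simp: tm_def tikhonov_def intro!: always_eventually add_increasing2)
  moreover have "(\<lambda>j. S (M (um (\<delta>j (r j)))) (yd (\<delta>j (r j)))) \<longlonglongrightarrow> 0"
    by (rule tendsto_sandwich[OF _ _ tendsto_const tm0])
      (auto simp: tm_def tikhonov_def intro!: always_eventually add_increasing2 add_increasing)
  moreover have "(\<lambda>j. S y (yd (\<delta>j (r j)))) \<longlonglongrightarrow> 0"
  proof (rule tendsto_sandwich[OF _ _ tendsto_const])
    show "\<forall>\<^sub>F j in sequentially. S y (yd (\<delta>j (r j))) \<le> ennreal (\<delta>j (r j))"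
      using noise pos by simp
    show "(\<lambda>j. ennreal (\<delta>j (r j))) \<longlonglongrightarrow> 0"
      using tendsto_ennrealI[OF LIMSEQ_subseq_LIMSEQ[OF lim r]] by (simp add: o_def)
  qed auto
  ultimately have zero: "Q (E z' u' f') = 0 \<and> S (M u') y = 0"
    using T2[rule_format, of "\<lambda>j. zm (\<delta>j (r j))" "\<lambda>j. um (\<delta>j (r j))" "\<lambda>j. fm (\<delta>j (r j))"
        z' u' f' "\<lambda>j. yd (\<delta>j (r j))"] in_spaces l by blast
  then show "M u' = y"
    using S by blast
  \<comment> \<open>\<open>Q\<close> is only known to be definite on \<open>\<W> \<times> H\<close>, so the residual at the limit has to
    be seen to lie there.\<close>
  have "z' \<in> Z" "u' \<in> VV" "f' \<in> CC"
    using limitin_topspace[OF l] top by auto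
  moreover obtain lam u0 \<alpha> where z': "z' = (lam, u0, \<alpha>)"
    by (cases z')
  ultimately have "fst (E z' u' f') \<in> WW"
    using Z derivative known nemytskii
    by (auto simp: E model_operator_def parameter_space_def intro!: L2_diff_in_subspace[OF WW])
  then show "E z' u' f' = (L2_zero T, 0)"
    using Q zero by (metis prod.collapse)
qed

end
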